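(* Let $C\subseteq\mathbb{F}_q^n$ be an $[n,k]$ code over $\mathbb{F}_q$ and let $T\subseteq[n]$. Then for any positive integer $m$ and all $0\le i\le n-|T|$, $0\le j\le|T|$, $$A_{i,j}^{q^m}(C;T)=\sum_{r=0}^{k}[m,r]_q\,A_{i,j}^{(r)}(C;T),$$ and consequently $$J_{C,T}(w,z,x,y;q^m)=\sum_{r=0}^{k}[m,r]_q\,J_{C,T}^{(r)}(w,z,x,y).$$
   Context: $q$ is a prime power, $[n]=\{1,\dots,n\}$, and $\overline{T}=[n]\setminus T$. An $[n,k]$ code over $\mathbb{F}_q$ is a $k$-dimensional $\mathbb{F}_q$-linear subspace of $\mathbb{F}_q^n$. For a positive integer $m$, the extension code $C[q^m]=C\otimes\mathbb{F}_{q^m}\subseteq\mathbb{F}_{q^m}^n$ is the set of all $\mathbb{F}_{q^m}$-linear combinations of codewords of $C$. For a vector $u$ and $S\subseteq[n]$, $\mathrm{wt}_S(u)=\#\{i\in S : u_i\ne0\}$. For a linear subspace $D\subseteq\mathbb{F}_q^n$, $\mathrm{Supp}(D)=\{i\in[n] : u_i\ne 0\text{ for some }u\in D\}$ and $\mathrm{wt}_S(D)=|\mathrm{Supp}(D)\cap S|$. $\mathcal{D}_r(C)$ is the set of $r$-dimensional $\mathbb{F}_q$-subspaces of $C$. Define $A_{i,j}^{q^m}(C;T)=\#\{u\in C[q^m] : \mathrm{wt}_{\overline{T}}(u)=i,\ \mathrm{wt}_T(u)=j\}$ and $A_{i,j}^{(r)}(C;T)=\#\{D\in\mathcal{D}_r(C)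 : \mathrm{wt}_{\overline{T}}(D)=i,\ \mathrm{wt}_T(D)=j\}$. The $q^m$-extended and the $r$-th higher Jacobi polynomials are $$J_{C,T}(w,z,x,y;q^m)=\sum_{i=0}^{n-|T|}\sum_{j=0}^{|T|}A_{i,j}^{q^m}(C;T)\,w^{|T|-j}z^{j}x^{n-|T|-i}y^{i},$$ $$J_{C,T}^{(r)}(w,z,x,y)=\sum_{i=0}^{n-|T|}\sum_{j=0}^{|T|}A_{i,j}^{(r)}(C;T)\,w^{|T|-j}z^{j}x^{n-|T|-i}y^{i}.$$ For integers $a,b\ge0$, $[a,b]_q=\prod_{i=0}^{b-1}(q^a-q^i)$. *)

theory Defs
  imports "HOL-Analysis.Cartesian_Space" "HOL-Library.Poly_Mapping"
begin

text \<open>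
  A finite field is a type \<open>'a :: {field, finite}\<close> with \<open>q = CARD('a)\<close>, and coordinates are
  indexed by a finite type \<open>'n\<close> with \<open>n = CARD('n)\<close>, in the role of \<open>{1, \<dots>, n}\<close>.
  The field of order \<open>q ^ m\<close> is a second type \<open>'b\<close> together with a ring
  homomorphism \<open>emb :: 'a \<Rightarrow> 'b\<close>, automatically injective.
\<close>

definition ext_code :: "('a::field \<Rightarrow> 'b::field) \<Rightarrow> ('a ^ 'n) set \<Rightarrow> ('b ^ 'n) set" where
  "ext_code emb C = vec.span ((\<lambda>u. \<chi> i. emb (u $ i)) ` C)"

definition wt :: "'n set \<Rightarrow> 'a::zero ^ 'n \<Rightarrow> nat" where
  "wt S u = card {i \<in> S. u $ i \<noteq> 0}"

definition Supp :: "('a::zero ^ 'n) set \<Rightarrow> 'n set" where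
  "Supp D = {i. \<exists>u\<in>D. u $ i \<noteq> 0}"

definition wt_space :: "'n set \<Rightarrow> ('a::zero ^ 'n) set \<Rightarrow> nat" where
  "wt_space S D = card (Supp D \<inter> S)"

definition subcodes :: "nat \<Rightarrow> ('a::field ^ 'n) set \<Rightarrow> ('a ^ 'n) set set" where
  "subcodes r C = {D. vec.subspace D \<and> D \<subseteq> C \<and> vec.dim D = r}"

definition A_ext ::
  "('a::field \<Rightarrow> 'b::field) \<Rightarrow> ('a ^ 'n) set \<Rightarrow> 'n set \<Rightarrow> nat \<Rightarrow> nat \<Rightarrow> nat" where
  "A_ext emb C T i j = card {u \<in> ext_code emb C. wt (- T) u = i \<and> wt T u = j}"

definition A_higher :: "nat \<Rightarrow> ('a::field ^ 'n) set \<Rightarrow> 'n set \<Rightarrow> nat \<Rightarrow> nat \<Rightarrow> nat" where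
  "A_higher r C T i j =
     card {D \<in> subcodes r C. wt_space (- T) D = i \<and> wt_space T D = j}"

definition qbracket :: "nat \<Rightarrow> nat \<Rightarrow> nat \<Rightarrow> int" where
  "qbracket q a b = (\<Prod>i<b. int q ^ a - int q ^ i)"

datatype jvar = W | Z | X | Y

text \<open>Formal polynomials in the four indeterminates with integer coefficients: finitely
  supported maps from exponent vectors to coefficients, multiplied by convolution.\<close>

type_synonym jpoly = "(jvar \<Rightarrow>\<^sub>0 nat) \<Rightarrow>\<^sub>0 int"

definition Var :: "jvar \<Rightarrow> jpoly" where
  "Var v = Poly_Mapping.single (Poly_Mapping.single v 1) 1"

definition jacobi_poly :: "'n::finite set \<Rightarrow> (nat \<Rightarrow> nat \<Rightarrow> nat) \<Rightarrow> jpoly" where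
  "jacobi_poly T A =
     (\<Sum>i = 0..CARD('n) - card T. \<Sum>j = 0..card T.
        of_nat (A i j) * Var W ^ (card T - j) * Var Z ^ j
          * Var X ^ (CARD('n) - card T - i) * Var Y ^ i)"

definition J_ext ::
  "('a::field \<Rightarrow> 'b::field) \<Rightarrow> ('a ^ 'n::finite) set \<Rightarrow> 'n set \<Rightarrow> jpoly" where
  "J_ext emb C T = jacobi_poly T (A_ext emb C T)"

definition J_higher :: "nat \<Rightarrow> ('a::field ^ 'n::finite) set \<Rightarrow> 'n set \<Rightarrow> jpoly" where
  "J_higher r C T = jacobi_poly T (A_higher r C T)"

end

theory Submission
  imports Defs
begin

text \<open>
  Write \<open>F\<close> and \<open>K\<close> for the fields of order \<open>q\<close> and \<open>q ^ m\<close>. A word \<open>u\<close> over \<open>K\<close> determines a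
  space of words over \<open>F\<close>: apply every \<open>F\<close>-linear functional \<open>K \<Rightarrow> F\<close> to the coordinates of \<open>u\<close>.
  This space, the descent of \<open>u\<close>, is the smallest subspace \<open>D\<close> with \<open>u\<close> in the extension of \<open>D\<close>
  (\<open>mem_ext_code_descent\<close>, \<open>descent_subset\<close>), so the words of the extended code are exactly
  those whose descent is a subcode. Functionals separate the points of \<open>K\<close>, hence a word and its
  descent have the same support (\<open>Supp_descent\<close>) and therefore the same weights on \<open>T\<close> and on its
  complement.

  It remains to count the words with a given descent \<open>D\<close> of dimension \<open>r\<close>. Fix a basis \<open>B\<close> of \<open>D\<close>.
  The words in the extension of \<open>D\<close> are the combinations of \<open>B\<close> with coefficients in \<open>K\<close>, each
  in a unique way, and such a combination has all of \<open>D\<close> as its descent precisely when its \<open>r\<close>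
  coefficients are linearly independent over \<open>F\<close> (\<open>descent_lin_comb_eq_span_iff\<close>): independent
  elements of \<open>K\<close> can be sent by a functional to arbitrary scalars, dependent ones cannot. The
  number of independent families of \<open>r\<close> elements in the \<open>m\<close>-dimensional space \<open>K\<close> is
  \<open>(q ^ m - 1) * \<dots> * (q ^ m - q ^ (r - 1))\<close>, which is the coefficient in the theorem.
  Summing over all subcodes with the prescribed weights gives the identity of the numbers, and
  the identity of the polynomials follows by linearity.
\<close>

section \<open>Independent families in a finite vector space\<close>

lemma (in vector_space) card_span_independent:
  assumes "finite S" and "independent S"
  shows "card (span S) = CARD('a) ^ card S"
proof -
  let ?c = "\<lambda>f. \<Sum>v\<in>S. scale (f v) v"
  have "inj_on ?c (S \<rightarrow>\<^sub>E UNIV)"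
  proof (rule inj_onI)
    fix f g assume f: "f \<in> S \<rightarrow>\<^sub>E UNIV" and g: "g \<in> S \<rightarrow>\<^sub>E UNIV" and eq: "?c f = ?c g"
    have "(\<Sum>v\<in>S. scale (f v - g v) v) = 0"
      using eq by (simp add: scale_left_diff_distrib sum_subtractf)
    then have "f v - g v = 0" if "v \<in> S" for v
      using independentD[OF assms(2,1) subset_refl, of "\<lambda>v. f v - g v"] that by blast
    then show "f = g"
      using f g by (intro PiE_ext) auto
  qed
  moreover have "?c ` (S \<rightarrow>\<^sub>E UNIV) = span S"
  proof -
    have "?c f \<in> ?c ` (S \<rightarrow>\<^sub>E UNIV)" for f
      by (rule image_eqI[of _ _ "restrict f S"]) auto
    then show ?thesis
      unfolding span_finite[OF assms(1)] by auto
  qed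
  ultimately have "card (span S) = card (S \<rightarrow>\<^sub>E (UNIV :: 'a set))"
    using card_image[of ?c "S \<rightarrow>\<^sub>E UNIV"] by simp
  then show ?thesis
    by (simp add: card_PiE assms(1))
qed

text \<open>
  Choose the members one after the other: each new one has to avoid the span of the \<open>i\<close> members
  already chosen, which has \<open>q ^ i\<close> elements. If there are more indices than the dimension
  allows, then both sides vanish, since the product contains the factor \<open>i = dim\<close>; this is why the
  count is stated over the integers.
\<close>

lemma (in vector_space) card_independent_families:
  assumes "finite I" and fin: "finite (UNIV :: 'b set)"
  shows "int (card {f \<in> I \<rightarrow>\<^sub>E UNIV. inj_on f I \<and> independent (f ` I)})
    = (\<Prod>i<card I. int CARD('b) - int CARD('a) ^ i)"
  using assms(1)
proof (induction I rule: finite_induct)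
  case empty
  have "{f \<in> {} \<rightarrow>\<^sub>E (UNIV :: 'b set). inj_on f {} \<and> independent (f ` {})} = {\<lambda>_. undefined}"
    using independent_empty by auto
  from arg_cong[OF this, of card] show ?case by simp
next
  case (insert d I)
  let ?F = "\<lambda>I. {f \<in> I \<rightarrow>\<^sub>E (UNIV :: 'b set). inj_on f I \<and> independent (f ` I)}"
  let ?P = "SIGMA f : ?F I. - span (f ` I)"
  have fun_upd_image: "(f(d := b)) ` I = f ` I" for f :: "'c \<Rightarrow> 'b" and b
    using insert.hyps by (auto simp: image_iff)
  have "bij_betw (\<lambda>(f, b). f(d := b)) ?P (?F (insert d I))"
  proof (rule bij_betw_byWitness[where f' = "\<lambda>g. (restrict g I, g d)"])
    show "\<forall>p\<in>?P. (\<lambda>g. (restrict g I, g d)) ((\<lambda>(f, b). f(d := b)) p) = p"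
      using insert.hyps by (auto simp: fun_eq_iff PiE_def extensional_def restrict_def)
    show "\<forall>g\<in>?F (insert d I). (\<lambda>(f, b). f(d := b)) (restrict g I, g d) = g"
      by (auto simp: fun_eq_iff PiE_def extensional_def restrict_def)
    show "(\<lambda>(f, b). f(d := b)) ` ?P \<subseteq> ?F (insert d I)"
    proof (rule image_subsetI)
      fix p assume "p \<in> ?P"
      then obtain f b where p: "p = (f, b)"
        and f: "f \<in> I \<rightarrow>\<^sub>E UNIV" "inj_on f I" "independent (f ` I)"
        and b: "b \<notin> span (f ` I)"
        by blast
      have b': "b \<notin> f ` I" using b span_base by blast
      have "f(d := b) \<in> insert d I \<rightarrow>\<^sub>E UNIV"
        using f(1) by (auto simp: PiE_def extensional_def)
      moreover have "inj_on (f(d := b)) (insert d I)"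
        using f(2) b' insert.hyps by (auto simp: inj_on_def)
      moreover have "independent (f(d := b) ` insert d I)"
        using f(3) b b' unfolding image_insert fun_upd_image
        by (simp add: independent_insert)
      ultimately show "(\<lambda>(f, b). f(d := b)) p \<in> ?F (insert d I)"
        unfolding p prod.case by (intro CollectI conjI)
    qed
    show "(\<lambda>g. (restrict g I, g d)) ` ?F (insert d I) \<subseteq> ?P"
    proof (rule image_subsetI)
      fix g assume "g \<in> ?F (insert d I)"
      then have g: "inj_on g (insert d I)" "independent (g ` insert d I)"
        by simp_all
      have "g d \<notin> g ` I" using g(1) insert.hyps by (auto simp: inj_on_def)
      then have "independent (g ` I)" "g d \<notin> span (g ` I)"
        using g(2) by (simp_all add: independent_insert)
      then show "(restrict g I, g d) \<in> ?P"
        using g(1) by (auto simp: inj_on_def)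
    qed
  qed
  then have "card (?F (insert d I)) = card ?P"
    by (rule bij_betw_same_card[symmetric])
  also have "\<dots> = (\<Sum>f\<in>?F I. card (- span (f ` I)))"
  proof (rule card_SigmaI)
    have "finite (I \<rightarrow>\<^sub>E (UNIV :: 'b set))"
      using insert.hyps fin by (intro finite_PiE) auto
    then show "finite (?F I)" by simp
    show "\<forall>f\<in>?F I. finite (- span (f ` I))"
      using finite_subset[OF subset_UNIV fin] by blast
  qed
  finally have "int (card (?F (insert d I))) = (\<Sum>f\<in>?F I. int (card (- span (f ` I))))"
    by simp
  also have "\<dots> = (\<Sum>f\<in>?F I. int CARD('b) - int CARD('a) ^ card I)"
  proof (rule sum.cong[OF refl])
    fix f assume "f \<in> ?F I"
    then have "card (span (f ` I)) = CARD('a) ^ card I"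
      using insert.hyps by (simp add: card_span_independent card_image)
    moreover have "card (- span (f ` I)) = CARD('b) - card (span (f ` I))"
      unfolding Compl_eq_Diff_UNIV using finite_subset[OF subset_UNIV fin]
      by (intro card_Diff_subset) auto
    moreover have "card (span (f ` I)) \<le> CARD('b)"
      by (rule card_mono[OF fin subset_UNIV])
    ultimately show "int (card (- span (f ` I))) = int CARD('b) - int CARD('a) ^ card I"
      by (simp add: of_nat_diff)
  qed
  also have "\<dots> = int (card (?F I)) * (int CARD('b) - int CARD('a) ^ card I)"
    by (rule sum_constant)
  also have "\<dots> = (\<Prod>i<card (insert d I). int CARD('b) - int CARD('a) ^ i)"
    unfolding insert.IH using insert.hyps by simp
  finally show ?case .
qed

section \<open>Descent along a field extension\<close>

text \<open>
  The extension is a type with an embedding of the base field; its structure of a vector space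
  over the base field is multiplication through the embedding.
\<close>

locale finite_field_extension =
  fixes emb :: "'a::{field,finite} \<Rightarrow> 'b::{field,finite}"
  assumes emb_one: "emb 1 = 1"
    and emb_add: "emb (a + b) = emb a + emb b"
    and emb_mult: "emb (a * b) = emb a * emb b"
begin

sublocale ext: vector_space "\<lambda>a b. emb a * b"
  by unfold_locales (simp_all add: emb_one emb_add emb_mult algebra_simps)

sublocale dual: vector_space_pair "\<lambda>a b. emb a * b" "(*)"
  by unfold_locales

abbreviation functional :: "('b \<Rightarrow> 'a) \<Rightarrow> bool" where
  "functional \<equiv> Vector_Spaces.linear (\<lambda>a b. emb a * b) (*)"

abbreviation embed_vec :: "'a ^ 'n \<Rightarrow> 'b ^ 'n" where
  "embed_vec v \<equiv> \<chi> i. emb (v $ i)"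

definition lin_comb :: "('a ^ 'n) set \<Rightarrow> ('a ^ 'n \<Rightarrow> 'b) \<Rightarrow> 'b ^ 'n" where
  "lin_comb B f = (\<Sum>d\<in>B. f d *s embed_vec d)"

text \<open>
  In terms of a basis of the larger field over the smaller one, this is the span of the coordinate
  vectors of \<open>u\<close>. Using all functionals avoids the choice of a basis.
\<close>

definition descent :: "'b ^ 'n \<Rightarrow> ('a ^ 'n) set" where
  "descent u = {\<chi> i. l (u $ i) | l. functional l}"

lemma descentI: "functional l \<Longrightarrow> (\<chi> i. l (u $ i)) \<in> descent u"
  unfolding descent_def by blast

lemma functional_add: "functional l \<Longrightarrow> l (x + y) = l x + l y"
  by (rule dual.linear_add)

lemma functional_scale: "functional l \<Longrightarrow> l (emb a * x) = a * l x"
  by (rule dual.linear_scale)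

lemma functional_sum: "functional l \<Longrightarrow> l (sum g S) = (\<Sum>s\<in>S. l (g s))"
  by (rule dual.linear_sum)

text \<open>
  Values on an independent family extend to a linear map. Both the separation of points and the
  computation of descents of linear combinations rest on this.
\<close>

lemma functional_prescribed:
  assumes "inj_on f I" and "ext.independent (f ` I)"
  obtains l where "functional l" and "\<And>d. d \<in> I \<Longrightarrow> l (f d) = c d"
proof -
  obtain l where "functional l" "\<forall>x\<in>f ` I. l x = c (inv_into I f x)"
    using dual.linear_independent_extend[OF assms(2), of "\<lambda>x. c (inv_into I f x)"] by blast
  then show ?thesis
    using that assms(1) by auto
qed

lemma functionals_separate:
  assumes "\<And>l. functional l \<Longrightarrow> l x = 0"
  shows "x = 0"
proof (rule ccontr)
  assume "x \<noteq> 0"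
  then have "ext.independent ((\<lambda>_. x) ` {()})"
    by (simp add: ext.dependent_single)
  then obtain l where "functional l" "l x = 1"
    by (rule functional_prescribed[where c = "\<lambda>_. 1", rotated]) auto
  then show False using assms[of l] by simp
qed

lemma functional_lin_comb:
  assumes "functional l"
  shows "(\<chi> i. l (lin_comb B f $ i)) = (\<Sum>d\<in>B. l (f d) *s d)"
proof -
  have "l (x * emb a) = l x * a" for x a
    using functional_scale[OF assms, of a x] by (simp add: mult.commute)
  then show ?thesis
    by (simp add: vec_eq_iff lin_comb_def functional_sum[OF assms])
qed

lemma descent_lin_comb:
  "descent (lin_comb B f) = {\<Sum>d\<in>B. l (f d) *s d | l. functional l}"
  unfolding descent_def by (rule Collect_cong) (simp add: functional_lin_comb cong: rev_conj_cong)

lemma subspace_descent: "vec.subspace (descent u)"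
proof (rule vec.subspaceI)
  have "functional (\<lambda>_. 0)" by (rule dual.linear_zero)
  then show "0 \<in> descent u"
    unfolding descent_def by (auto simp: vec_eq_iff)
next
  fix v w assume "v \<in> descent u" "w \<in> descent u"
  then obtain l l' where l: "functional l" "functional l'"
    and vw: "v = (\<chi> i. l (u $ i))" "w = (\<chi> i. l' (u $ i))"
    unfolding descent_def by auto
  have "v + w = (\<chi> i. l (u $ i) + l' (u $ i))"
    by (simp add: vw vec_eq_iff)
  also have "\<dots> \<in> descent u"
    by (rule descentI[OF dual.linear_compose_add[OF l]])
  finally show "v + w \<in> descent u" .
next
  fix c v assume "v \<in> descent u"
  then obtain l where l: "functional l" and v: "v = (\<chi> i. l (u $ i))"
    unfolding descent_def by auto
  have "c *s v = (\<chi> i. c * l (u $ i))"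
    by (simp add: v vec_eq_iff)
  also have "\<dots> \<in> descent u"
    by (rule descentI[OF dual.linear_compose_scale_right[OF l]])
  finally show "c *s v \<in> descent u" .
qed

lemma Supp_descent: "Supp (descent u) = {i. u $ i \<noteq> 0}"
proof -
  have "(\<exists>l. functional l \<and> l x \<noteq> 0) \<longleftrightarrow> x \<noteq> 0" for x
    using functionals_separate dual.linear_0 by blast
  moreover have "(\<exists>v\<in>descent u. v $ i \<noteq> 0) \<longleftrightarrow> (\<exists>l. functional l \<and> l (u $ i) \<noteq> 0)" for i
    unfolding descent_def by auto
  ultimately show ?thesis
    unfolding Supp_def by simp
qed

lemma wt_space_descent: "wt_space S (descent u) = wt S u"
proof -
  have "{i. u $ i \<noteq> 0} \<inter> S = {i \<in> S. u $ i \<noteq> 0}" by auto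
  then show ?thesis
    unfolding wt_space_def wt_def Supp_descent by simp
qed

text \<open>
  Expand the coordinates of \<open>u\<close> in a basis \<open>E\<close> of the larger field: the coordinate maps are
  functionals, so \<open>u\<close> is a combination, with coefficients \<open>e \<in> E\<close>, of embedded members of its descent.
\<close>

lemma mem_ext_code_descent: "u \<in> ext_code emb (descent u)"
proof -
  define E :: "'b set" where "E = ext.extend_basis {}"
  then have E: "ext.independent E" "ext.span E = UNIV"
    by (simp_all add: ext.independent_extend_basis ext.span_extend_basis ext.independent_empty)
  let ?l = "\<lambda>e x. ext.representation E x e"
  have l: "functional (?l e)" for e
    unfolding Vector_Spaces.linear_iff
    by (simp add: ext.representation_add ext.representation_scale E ext.vector_space_axioms
        vector_space_over_itself.vector_space_axioms)
  have "x = (\<Sum>e\<in>E. emb (?l e x) * e)" for x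
    using ext.sum_representation_eq[OF E(1), of x E] E by simp
  then have "u = (\<Sum>e\<in>E. e *s embed_vec (\<chi> i. ?l e (u $ i)))"
    by (simp add: vec_eq_iff mult.commute)
  also have "\<dots> \<in> ext_code emb (descent u)"
    unfolding ext_code_def
    by (intro vec.span_sum vec.span_scale vec.span_base imageI descentI[OF l])
  finally show ?thesis .
qed

text \<open>
  A functional sends a multiple \<open>c\<close> of an embedded word \<open>v\<close> to a scalar multiple of \<open>v\<close> itself, so
  it maps the extension of \<open>D\<close> into \<open>D\<close>. Together with the preceding lemma this characterises
  the descent as the least subspace whose extension contains \<open>u\<close>.
\<close>

lemma descent_subset:
  assumes "vec.subspace D" and "u \<in> ext_code emb D"
  shows "descent u \<subseteq> D"
proof -
  have "(\<chi> i. l (u $ i)) \<in> D" if l: "functional l" for l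
    using assms(2) unfolding ext_code_def
  proof (induction rule: vec.span_induct_alt)
    case base
    have "l 0 = 0" using l by (rule dual.linear_0)
    then show ?case
      using vec.subspace_0[OF assms(1)] by (simp add: zero_vec_def)
  next
    case (step c x y)
    then obtain v where v: "v \<in> D" "x = embed_vec v" by blast
    have "(\<chi> i. l ((c *s x + y) $ i)) = l c *s v + (\<chi> i. l (y $ i))"
      using v functional_scale[OF l] functional_add[OF l] by (simp add: vec_eq_iff mult.commute)
    then show ?case
      using v step by (simp add: vec.subspace_add vec.subspace_scale assms(1))
  qed
  then show ?thesis
    unfolding descent_def by blast
qed

lemma ext_code_mono: "D \<subseteq> C \<Longrightarrow> ext_code emb D \<subseteq> ext_code emb C"
  unfolding ext_code_def by (intro vec.span_mono image_mono)

section \<open>Words with a given descent\<close>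

text \<open>
  Vectors that are independent over the smaller field stay independent over the larger one: a
  functional turns a relation between the embedded vectors into one between the original vectors,
  and functionals separate points.
\<close>

lemma inj_on_lin_comb:
  assumes "vec.independent B"
  shows "inj_on (lin_comb B) (B \<rightarrow>\<^sub>E UNIV)"
proof (rule inj_onI)
  fix f g assume fg: "f \<in> B \<rightarrow>\<^sub>E UNIV" "g \<in> B \<rightarrow>\<^sub>E UNIV" and eq: "lin_comb B f = lin_comb B g"
  have "f d - g d = 0" if "d \<in> B" for d
  proof (rule functionals_separate)
    fix l assume l: "functional l"
    have "(\<Sum>d\<in>B. l (f d) *s d) = (\<Sum>d\<in>B. l (g d) *s d)"
      unfolding functional_lin_comb[OF l, symmetric] eq ..
    then have "(\<Sum>d\<in>B. (l (f d) - l (g d)) *s d) = 0"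
      by (simp add: vec.scale_left_diff_distrib sum_subtractf)
    then have "l (f d) - l (g d) = 0"
      using vec.independentD[OF assms _ subset_refl, of "\<lambda>d. l (f d) - l (g d)"] that
      by simp
    then show "l (f d - g d) = 0"
      using dual.linear_diff[OF l] by simp
  qed
  then show "f = g"
    using fg by (intro PiE_ext) auto
qed

lemma ext_code_span: "ext_code emb (vec.span B) = lin_comb B ` (B \<rightarrow>\<^sub>E UNIV)"
proof
  have "embed_vec v \<in> vec.span (embed_vec ` B)" if "v \<in> vec.span B" for v
    using that
  proof (induction rule: vec.span_induct_alt)
    case base
    have "emb 0 = 0"
      using ext.scale_zero_left[of 1] by simp
    then have "embed_vec 0 = 0"
      by (simp add: vec_eq_iff)
    then show ?case by (metis vec.span_zero)
  next
    case (step c x y)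
    have "embed_vec (c *s x + y) = emb c *s embed_vec x + embed_vec y"
      by (simp add: vec_eq_iff emb_add emb_mult)
    then show ?case
      using step by (simp add: vec.span_add vec.span_scale vec.span_base)
  qed
  then have "ext_code emb (vec.span B) \<subseteq> vec.span (embed_vec ` B)"
    unfolding ext_code_def by (intro vec.span_minimal) auto
  also have "\<dots> \<subseteq> range (lin_comb B)"
  proof (rule vec.span_minimal)
    show "embed_vec ` B \<subseteq> range (lin_comb B)"
    proof clarify
      fix d assume "d \<in> B"
      then have "embed_vec d = lin_comb B (\<lambda>v. if v = d then 1 else 0)"
        by (simp add: lin_comb_def if_distrib[of "\<lambda>a. a *s _"] sum.delta cong: if_cong)
      then show "embed_vec d \<in> range (lin_comb B)" by blast
    qed
    show "vec.subspace (range (lin_comb B))"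
    proof (rule vec.subspaceI)
      have "0 = lin_comb B (\<lambda>_. 0)" by (simp add: lin_comb_def)
      then show "0 \<in> range (lin_comb B)" by blast
    next
      fix x y assume "x \<in> range (lin_comb B)" "y \<in> range (lin_comb B)"
      then obtain f g where "x = lin_comb B f" "y = lin_comb B g" by blast
      then have "x + y = lin_comb B (\<lambda>d. f d + g d)"
        by (simp add: lin_comb_def vec.scale_left_distrib sum.distrib)
      then show "x + y \<in> range (lin_comb B)" by blast
    next
      fix c x assume "x \<in> range (lin_comb B)"
      then obtain f where "x = lin_comb B f" by blast
      then have "c *s x = lin_comb B (\<lambda>d. c * f d)"
        by (simp add: lin_comb_def vec.scale_sum_right)
      then show "c *s x \<in> range (lin_comb B)" by blast
    qed
  qed
  also have "\<dots> \<subseteq> lin_comb B ` (B \<rightarrow>\<^sub>E UNIV)"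
  proof clarify
    fix f
    have "lin_comb B f = lin_comb B (restrict f B)"
      by (simp add: lin_comb_def)
    then show "lin_comb B f \<in> lin_comb B ` (B \<rightarrow>\<^sub>E UNIV)"
      by (rule image_eqI[of _ "lin_comb B" "restrict f B"]) simp
  qed
  finally show "ext_code emb (vec.span B) \<subseteq> lin_comb B ` (B \<rightarrow>\<^sub>E UNIV)" .
next
  show "lin_comb B ` (B \<rightarrow>\<^sub>E UNIV) \<subseteq> ext_code emb (vec.span B)"
    unfolding ext_code_def lin_comb_def
    by (intro image_subsetI vec.span_sum vec.span_scale) (intro vec.span_base imageI)
qed

text \<open>
  The descent consists of the combinations of \<open>B\<close> with coefficients \<open>l (f d)\<close>, for \<open>l\<close> a functional.
  For an independent family \<open>f\<close> these coefficients can be prescribed freely. Conversely, if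
  every element of \<open>B\<close> is reached, then some functional is \<open>1\<close> at one member of \<open>f\<close> and \<open>0\<close> at the
  others, and these dual functionals rule out repetitions and linear relations.
\<close>

lemma descent_lin_comb_eq_span_iff:
  assumes B: "vec.independent B"
  shows "descent (lin_comb B f) = vec.span B \<longleftrightarrow> inj_on f B \<and> ext.independent (f ` B)"
proof
  assume "inj_on f B \<and> ext.independent (f ` B)"
  then have inj: "inj_on f B" and indep: "ext.independent (f ` B)" by simp_all
  have "(\<Sum>d\<in>B. c d *s d) \<in> descent (lin_comb B f)" for c
  proof -
    obtain l where l: "functional l" "\<And>d. d \<in> B \<Longrightarrow> l (f d) = c d"
      using functional_prescribed[OF inj indep, of c] by blast
    have "(\<Sum>d\<in>B. c d *s d) = (\<Sum>d\<in>B. l (f d) *s d)"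
      using l(2) by (intro sum.cong) auto
    then show ?thesis
      unfolding descent_lin_comb using l(1) by blast
  qed
  then show "descent (lin_comb B f) = vec.span B"
    unfolding vec.span_finite[OF finite] descent_lin_comb by auto
next
  assume eq: "descent (lin_comb B f) = vec.span B"
  have coord: "\<exists>l. functional l \<and> (\<forall>b\<in>B. l (f b) = (if b = d then 1 else 0))" if "d \<in> B" for d
  proof -
    have "d \<in> descent (lin_comb B f)"
      using eq that vec.span_base by blast
    then obtain l where l: "functional l" "d = (\<Sum>b\<in>B. l (f b) *s b)"
      unfolding descent_lin_comb by blast
    have "d = (\<Sum>b\<in>B. (if b = d then 1 else 0) *s b)"
      using that by (simp add: if_distrib[of "\<lambda>a. a *s _"] sum.delta cong: if_cong)
    then have "(\<Sum>b\<in>B. (l (f b) - (if b = d then 1 else 0)) *s b) = 0"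
      using l(2) by (simp only: vec.scale_left_diff_distrib sum_subtractf) simp
    then have "\<forall>b\<in>B. l (f b) - (if b = d then 1 else 0) = 0"
      using vec.independentD[OF B finite subset_refl,
          of "\<lambda>b. l (f b) - (if b = d then 1 else 0)"] by blast
    then show ?thesis using l(1) by auto
  qed
  have inj: "inj_on f B"
  proof (rule inj_onI)
    fix b d assume "b \<in> B" "d \<in> B" "f b = f d"
    then show "b = d" using coord[of d] by (metis one_neq_zero)
  qed
  moreover have "ext.independent (f ` B)"
  proof (rule ext.independent_if_scalars_zero)
    fix c x assume sum0: "(\<Sum>x\<in>f ` B. emb (c x) * x) = 0" and "x \<in> f ` B"
    then obtain d where d: "d \<in> B" "x = f d" by blast
    obtain l where l: "functional l" "\<forall>b\<in>B. l (f b) = (if b = d then 1 else 0)"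
      using coord[OF d(1)] by blast
    have "0 = l (\<Sum>b\<in>B. emb (c (f b)) * f b)"
      using sum0 dual.linear_0[OF l(1)] by (simp add: sum.reindex[OF inj])
    also have "\<dots> = (\<Sum>b\<in>B. c (f b) * (if b = d then 1 else 0))"
      using l by (simp add: functional_sum functional_scale)
    also have "\<dots> = c (f d)"
      using d by (simp add: if_distrib[of "(*) _"] sum.delta cong: if_cong)
    finally show "c x = 0" using d by simp
  qed simp
  ultimately show "inj_on f B \<and> ext.independent (f ` B)" ..
qed

text \<open>
  Coefficient families over a basis of \<open>D\<close> parametrise the words in the extension of \<open>D\<close>, and the
  independent ones among them give the words with descent \<open>D\<close>.
\<close>

lemma card_descent_fibre:
  assumes "vec.subspace D" and card_ext: "CARD('b) = CARD('a) ^ m"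
  shows "int (card {u. descent u = D}) = qbracket CARD('a) m (vec.dim D)"
proof -
  obtain B where B: "vec.independent B" "vec.span B = D" "card B = vec.dim D"
    using vec.basis_exists[of D] vec.span_minimal[OF _ assms(1)] by (metis subset_antisym)
  let ?F = "{f \<in> B \<rightarrow>\<^sub>E UNIV. inj_on f B \<and> ext.independent (f ` B)}"
  have "{u. descent u = D} = lin_comb B ` ?F"
  proof
    show "{u. descent u = D} \<subseteq> lin_comb B ` ?F"
    proof clarify
      fix u assume u: "D = descent u"
      then have "u \<in> ext_code emb (vec.span B)"
        using mem_ext_code_descent[of u] B(2) by simp
      then obtain f where "f \<in> B \<rightarrow>\<^sub>E UNIV" "u = lin_comb B f"
        unfolding ext_code_span by blast
      then show "u \<in> lin_comb B ` ?F"
        using u B descent_lin_comb_eq_span_iff[OF B(1), of f] by blast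
    qed
    show "lin_comb B ` ?F \<subseteq> {u. descent u = D}"
      using B descent_lin_comb_eq_span_iff[OF B(1)] by blast
  qed
  moreover have "inj_on (lin_comb B) ?F"
    by (rule inj_on_subset[OF inj_on_lin_comb[OF B(1)]]) auto
  ultimately have "card {u. descent u = D} = card ?F"
    by (simp add: card_image)
  then show ?thesis
    by (simp add: ext.card_independent_families B(3) card_ext qbracket_def)
qed

section \<open>Extended and higher weight enumerators\<close>

text \<open>
  The words counted on the left are partitioned by their descents, which run through the
  subcodes with the same weights.
\<close>

theorem A_ext_eq_sum_A_higher:
  fixes C :: "('a ^ 'n) set"
  assumes C: "vec.subspace C" and card_ext: "CARD('b) = CARD('a) ^ m"
  shows "int (A_ext emb C T i j) =
    (\<Sum>r = 0..vec.dim C. qbracket CARD('a) m r * int (A_higher r C T i j))"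
proof -
  let ?S = "\<lambda>r. {D \<in> subcodes r C. wt_space (- T) D = i \<and> wt_space T D = j}"
  let ?fib = "\<lambda>D. {u. descent u = D}"
  have "{u \<in> ext_code emb C. wt (- T) u = i \<and> wt T u = j} =
      (\<Union>r\<in>{0..vec.dim C}. \<Union>D\<in>?S r. ?fib D)"
  proof (intro equalityI subsetI)
    fix u assume "u \<in> {u \<in> ext_code emb C. wt (- T) u = i \<and> wt T u = j}"
    then have "descent u \<in> ?S (vec.dim (descent u))" "vec.dim (descent u) \<le> vec.dim C"
      using descent_subset[OF C] subspace_descent
      by (auto simp: subcodes_def wt_space_descent intro!: vec.dim_subset)
    then show "u \<in> (\<Union>r\<in>{0..vec.dim C}. \<Union>D\<in>?S r. ?fib D)" by auto
  next
    fix u assume "u \<in> (\<Union>r\<in>{0..vec.dim C}. \<Union>D\<in>?S r. ?fib D)"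
    then have "descent u \<subseteq> C" "wt (- T) u = i" "wt T u = j"
      by (auto simp: subcodes_def wt_space_descent)
    then show "u \<in> {u \<in> ext_code emb C. wt (- T) u = i \<and> wt T u = j}"
      using mem_ext_code_descent ext_code_mono by blast
  qed
  then have "A_ext emb C T i j = card (\<Union>r\<in>{0..vec.dim C}. \<Union>D\<in>?S r. ?fib D)"
    by (simp add: A_ext_def)
  also have "\<dots> = (\<Sum>r = 0..vec.dim C. card (\<Union>D\<in>?S r. ?fib D))"
    by (rule card_UN_disjoint) (auto simp: subcodes_def)
  also have "\<dots> = (\<Sum>r = 0..vec.dim C. \<Sum>D\<in>?S r. card (?fib D))"
    by (intro sum.cong refl card_UN_disjoint) auto
  finally have "int (A_ext emb C T i j) = (\<Sum>r = 0..vec.dim C. \<Sum>D\<in>?S r. int (card (?fib D)))"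
    by simp
  also have "\<dots> = (\<Sum>r = 0..vec.dim C. \<Sum>D\<in>?S r. qbracket CARD('a) m r)"
    by (intro sum.cong refl) (auto simp: subcodes_def card_descent_fibre[OF _ card_ext])
  finally show ?thesis
    by (simp add: A_higher_def mult.commute)
qed

end

lemma jacobi_poly_sum:
  fixes T :: "'n::finite set" and A :: "nat \<Rightarrow> nat \<Rightarrow> nat"
  assumes "\<And>i j. int (A i j) = (\<Sum>r\<in>R. c r * int (B r i j))"
  shows "jacobi_poly T A = (\<Sum>r\<in>R. of_int (c r) * jacobi_poly T (B r))"
proof -
  have "of_nat (A i j) = (\<Sum>r\<in>R. of_int (c r) * of_nat (B r i j) :: jpoly)" for i j
    using arg_cong[OF assms[of i j], of "of_int :: int \<Rightarrow> jpoly"] by simp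
  then show ?thesis
    unfolding jacobi_poly_def
    by (simp add: sum_distrib_left sum_distrib_right mult.assoc sum.swap[of _ R])
qed

theorem theorem4p1:
  fixes C :: "('a::{field,finite} ^ 'n::finite) set"
    and T :: "'n set"
    and k m :: nat
    and emb :: "'a \<Rightarrow> 'b::{field,finite}"
  assumes code: "vec.subspace C" "vec.dim C = k"
    and m_pos: "m \<ge> 1"
    and card_ext: "CARD('b) = CARD('a) ^ m"
    and emb_one: "emb 1 = 1"
    and emb_add: "\<And>a b. emb (a + b) = emb a + emb b"
    and emb_mult: "\<And>a b. emb (a * b) = emb a * emb b"
  shows "(\<forall>i \<le> CARD('n) - card T. \<forall>j \<le> card T.
            int (A_ext emb C T i j) =
              (\<Sum>r = 0..k. qbracket CARD('a) m r * int (A_higher r C T i j)))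
       \<and> J_ext emb C T = (\<Sum>r = 0..k. of_int (qbracket CARD('a) m r) * J_higher r C T)"
proof -
  interpret finite_field_extension emb
    by unfold_locales (fact emb_one emb_add emb_mult)+
  have "int (A_ext emb C T i j) =
      (\<Sum>r = 0..k. qbracket CARD('a) m r * int (A_higher r C T i j))" for i j
    using A_ext_eq_sum_A_higher[OF code(1) card_ext] code(2) by simp
  then show ?thesis
    unfolding J_ext_def J_higher_def by (intro conjI allI impI jacobi_poly_sum)
qed

end
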